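(* Fix an integer $c\geq 2$, a positive integer $n$, and positive integers $e_1,\dots,e_n$. Let $u=I_{c}^{e_{1}}D_{c}^{e_{2}}I_{c}^{e_{3}}\ldots \mathcal{L}_{c}^{e_{n}}$, where $\mathcal{L}$ is $I$ if $n$ is odd and $D$ if $n$ is even. Define $A= \sum_{i\geq 1}e_{2i-1}$, $B = \sum_{i\geq 1}e_{2i}$, $M= \max(A, B)$, $m= \min(A, B)$. Then $\mathit{l}(u)=(c-1)m+M+ \lfloor n/2\rfloor$.
   Context: A sequence $s$ contains a sequence $u$ if some subsequence of $s$ can be changed into $u$ by a one-to-one renaming of its letters. $I_c$ denotes the sequence $1\,2\ldots c$ and $D_c$ the sequence $c\,(c-1)\ldots 1$; powers denote repeated concatenation. $\mathit{up}(c,k)$ is $I_c$ repeated $k$ times. For a sequence $u$ with $c$ distinct letters, $\mathit{l}(u)$ is the smallest $k$ such that $\mathit{up}(c,k)$ contains $u$. *)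

theory Defs
  imports Main "HOL-Library.Sublist"
begin

definition contains :: "'a list \<Rightarrow> 'b list \<Rightarrow> bool" where
  "contains s u \<longleftrightarrow> (\<exists>t f. subseq t s \<and> inj_on f (set t) \<and> map f t = u)"

definition rep :: "nat \<Rightarrow> 'a list \<Rightarrow> 'a list" where
  "rep k s = concat (replicate k s)"

definition I_seq :: "nat \<Rightarrow> nat list" where
  "I_seq c = [1..<Suc c]"

definition D_seq :: "nat \<Rightarrow> nat list" where
  "D_seq c = rev [1..<Suc c]"

definition up :: "nat \<Rightarrow> nat \<Rightarrow> nat list" where
  "up c k = rep k (I_seq c)"

(* The set of such k is never empty (k = length u works), so LEAST is a genuine minimum. *)
definition ell :: "'a list \<Rightarrow> nat" where
  "ell u = (LEAST k. contains (up (card (set u)) k) u)"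

(* Blocks are numbered 1, ..., n; only the values e 1, ..., e n are used. *)
definition alt_seq :: "nat \<Rightarrow> nat \<Rightarrow> (nat \<Rightarrow> nat) \<Rightarrow> nat list" where
  "alt_seq c n e =
     concat (map (\<lambda>i. rep (e i) (if odd i then I_seq c else D_seq c)) [1..<Suc n])"

end

theory Submission
  imports Defs
begin

text \<open>
  Reading a word \<open>w\<close> over \<open>{1..c}\<close> greedily inside \<open>up c k\<close>, a new copy of \<open>I_c\<close> is needed exactly at
  each weak descent of \<open>w\<close>. Hence \<open>ell u\<close> is one more than the least number of weak descents of a
  relabelling \<open>g u\<close>. In \<open>I_c\<close> read cyclically \<open>g\<close> has some number \<open>p\<close> of descents, in \<open>D_c\<close> it has
  \<open>q = c - p\<close>, both at least 1. Counting block by block gives \<open>A p + B q\<close> plus a term that is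
  \<open>n div 2\<close> if \<open>g 1 < g c\<close> and \<open>n - n div 2\<close> otherwise. The minimum is attained at \<open>p = 1\<close> or \<open>q = 1\<close>.
\<close>

section \<open>Weak descents under deletion and reversal\<close>

fun weak_descents :: "'a::linorder list \<Rightarrow> nat" where
  "weak_descents [] = 0"
| "weak_descents [x] = 0"
| "weak_descents (x # y # xs) = of_bool (y \<le> x) + weak_descents (y # xs)"

lemma weak_descents_append:
  assumes "xs \<noteq> []" "ys \<noteq> []"
  shows "weak_descents (xs @ ys) =
    weak_descents xs + of_bool (hd ys \<le> last xs) + weak_descents ys"
  using assms
proof (induction xs rule: weak_descents.induct)
  case (2 x)
  then show ?case by (cases ys) auto
qed auto

lemma weak_descents_Cons_le: "weak_descents xs \<le> weak_descents (x # xs)"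
  by (cases xs) auto

lemma weak_descents_insert_le: "weak_descents (x # ys) \<le> weak_descents (x # y # ys)"
  by (cases ys) auto

text \<open>If \<open>z \<le> x\<close>, then \<open>y \<le> x\<close> or \<open>z \<le> y\<close>,
  so deleting \<open>y\<close> between \<open>x\<close> and \<open>z\<close> cannot raise the count.
  This is the source of the lower bound on \<open>k\<close>.\<close>

lemma weak_descents_mono:
  assumes "subseq xs ys"
  shows "weak_descents xs \<le> weak_descents ys"
proof -
  \<comment> \<open>When both words gain the same first letter, the new comparison depends on what
    follows it; the second conjunct carries this through the induction.\<close>
  have "weak_descents xs \<le> weak_descents ys \<and>
      (\<forall>x. weak_descents (x # xs) \<le> weak_descents (x # ys))"
    using assms
  proof (induction rule: list_emb.induct)
    case (list_emb_Nil ys)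
    then show ?case by simp
  next
    case (list_emb_Cons xs ys y)
    then show ?case
      using weak_descents_Cons_le weak_descents_insert_le le_trans by metis
  next
    case (list_emb_Cons2 x y xs ys)
    then show ?case by simp
  qed
  then show ?thesis by simp
qed

text \<open>Each of the \<open>length xs - 1\<close> adjacent pairs descends in exactly one of the
  two reading directions.\<close>

lemma weak_descents_rev:
  assumes "distinct xs" "xs \<noteq> []"
  shows "weak_descents xs + weak_descents (rev xs) + 1 = length xs"
  using assms
proof (induction xs rule: weak_descents.induct)
  case (3 x y xs)
  have "weak_descents (rev (x # y # xs)) =
      weak_descents (rev (y # xs)) + of_bool (x \<le> y)"
    using weak_descents_append[of "rev (y # xs)" "[x]"] by simp
  moreover have "of_bool (x \<le> y) + of_bool (y \<le> x) = (1::nat)"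
    using "3.prems" by auto
  ultimately show ?case
    using 3 by simp
qed auto

lemma weak_descents_strict_sorted:
  "sorted_wrt (<) xs \<Longrightarrow> weak_descents xs = 0"
  by (induction xs rule: weak_descents.induct) auto

section \<open>Repeated words and the blocks \<open>I_seq\<close>, \<open>D_seq\<close>\<close>

lemma rep_simps [simp]: "rep 0 s = []" "rep (Suc k) s = s @ rep k s"
  by (simp_all add: rep_def)

lemma set_rep: "0 < k \<Longrightarrow> set (rep k s) = set s"
  by (auto simp: rep_def)

lemma rep_eq_Nil [simp]: "rep k s = [] \<longleftrightarrow> k = 0 \<or> s = []"
  by (cases k) (auto simp: rep_def)

lemma hd_rep: "0 < k \<Longrightarrow> s \<noteq> [] \<Longrightarrow> hd (rep k s) = hd s"
  by (cases k) auto

lemma last_rep: "0 < k \<Longrightarrow> s \<noteq> [] \<Longrightarrow> last (rep k s) = last s"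
  by (induction k) (auto simp: last_append)

lemma map_rep: "map f (rep k s) = rep k (map f s)"
  by (simp add: rep_def map_concat)

text \<open>The \<open>k\<close> copies have only \<open>k - 1\<close> junctions; the indicator on
  the left supplies the missing closing one and avoids subtraction.\<close>

lemma weak_descents_rep:
  assumes "s \<noteq> []" "0 < k"
  shows "weak_descents (rep k s) + of_bool (hd s \<le> last s) =
    k * (weak_descents s + of_bool (hd s \<le> last s))"
  using assms(2)
proof (induction k rule: nat_induct_non_zero)
  case (Suc k)
  then show ?case
    using assms(1) by (simp add: weak_descents_append hd_rep)
qed simp

lemma I_seq_facts:
  assumes "0 < c"
  shows "I_seq c \<noteq> []" "hd (I_seq c) = 1" "last (I_seq c) = c"
    "set (I_seq c) = {1..c}" "distinct (I_seq c)" "length (I_seq c) = c"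
    "weak_descents (I_seq c) = 0"
  using assms
  by (auto simp: I_seq_def last_upt weak_descents_strict_sorted simp del: upt_Suc)

lemma D_seq_rev: "D_seq c = rev (I_seq c)"
  by (simp add: D_seq_def I_seq_def)

lemma weak_descents_up:
  assumes "0 < c" "0 < k"
  shows "weak_descents (up c k) + 1 = k"
  using weak_descents_rep[of "I_seq c" k] assms
  by (simp add: up_def I_seq_facts)

section \<open>Greedy embedding and the reduction of \<open>ell\<close> to weak descents\<close>

lemma subseq_upt: "a \<le> b \<Longrightarrow> subseq [b..<c] [a..<c]"
  using upt_add_eq_append[of a b "c - b"] by (cases "b \<le> c") (simp_all add: list_emb_append2)

lemma subseq_up:
  assumes "set w \<subseteq> {1..c}"
  shows "subseq w (up c (Suc (weak_descents w)))"
proof (cases w)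
  case (Cons x xs)
  \<comment> \<open>Strengthened for the induction: reading starts inside a copy, at the first
    letter \<open>x\<close>, and each weak descent pays for one further full copy.\<close>
  have "subseq (x # xs) ([x..<Suc c] @ up c (weak_descents (x # xs)))"
    using assms unfolding Cons
  proof (induction xs arbitrary: x)
    case Nil
    then show ?case by (simp add: upt_conv_Cons del: upt_Suc)
  next
    case (Cons y ys)
    let ?k = "weak_descents (y # ys)"
    have IH: "subseq (y # ys) ([y..<Suc c] @ up c ?k)"
      using Cons by simp
    have x: "[x..<Suc c] = x # [Suc x..<Suc c]"
      using Cons.prems by (simp add: upt_conv_Cons del: upt_Suc)
    show ?case
    proof (cases "y \<le> x")
      case True
      \<comment> \<open>The rest of the current copy is skipped and \<open>y\<close> is read from
        the next one.\<close>
      have "subseq [y..<Suc c] ([Suc x..<Suc c] @ [1..<Suc c])"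
        using subseq_upt[of 1 y "Suc c"] Cons.prems by (intro list_emb_append2) auto
      then have "subseq ([y..<Suc c] @ up c ?k) (([Suc x..<Suc c] @ [1..<Suc c]) @ up c ?k)"
        by (rule list_emb_append_mono) simp
      with IH have "subseq (y # ys) (([Suc x..<Suc c] @ [1..<Suc c]) @ up c ?k)"
        by (rule subseq_order.trans)
      then show ?thesis
        using True x by (simp add: up_def I_seq_def del: upt_Suc)
    next
      case False
      then have "subseq [y..<Suc c] [Suc x..<Suc c]"
        by (intro subseq_upt) simp
      then have "subseq ([y..<Suc c] @ up c ?k) ([Suc x..<Suc c] @ up c ?k)"
        by (rule list_emb_append_mono) simp
      with IH have "subseq (y # ys) ([Suc x..<Suc c] @ up c ?k)"
        by (rule subseq_order.trans)
      then show ?thesis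
        using False x by (simp del: upt_Suc)
    qed
  qed
  moreover have "subseq ([x..<Suc c] @ up c (weak_descents w)) (up c (Suc (weak_descents w)))"
    using subseq_upt[of 1 x "Suc c"] assms Cons
    by (simp add: up_def I_seq_def del: upt_Suc)
  ultimately show ?thesis
    using Cons subseq_order.trans by blast
qed simp

text \<open>Inverting the renaming turns a choice of subsequence into a choice of labels for
  \<open>u\<close>, over which one can then minimise.\<close>

lemma contains_iff_relabelling:
  "contains s u \<longleftrightarrow> (\<exists>g. inj_on g (set u) \<and> subseq (map g u) s)"
proof
  assume "contains s u"
  then obtain t f where t: "subseq t s" "inj_on f (set t)" "map f t = u"
    by (auto simp: contains_def)
  have "map (inv_into (set t) f) u = t"
    using t by (auto simp: map_idI)
  moreover have "inj_on (inv_into (set t) f) (set u)"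
    using t by (auto intro: inj_on_inv_into)
  ultimately show "\<exists>g. inj_on g (set u) \<and> subseq (map g u) s"
    using t(1) by metis
next
  assume "\<exists>g. inj_on g (set u) \<and> subseq (map g u) s"
  then obtain g where g: "inj_on g (set u)" "subseq (map g u) s"
    by blast
  have "map (inv_into (set u) g) (map g u) = u"
    using g by (auto simp: map_idI)
  moreover have "inj_on (inv_into (set u) g) (set (map g u))"
    by (auto intro: inj_on_inv_into)
  ultimately show "contains s u"
    unfolding contains_def using g(2) by blast
qed

text \<open>The greedy embedding of \<open>map g u\<close> gives the upper bound. Conversely, if
  \<open>map h u\<close> embeds into \<open>k\<close> copies, monotonicity leaves it at most
  \<open>k - 1\<close> weak descents.\<close>

lemma ell_eqI:
  assumes "u \<noteq> []" and g: "inj_on g (set u)" "g ` set u \<subseteq> {1..card (set u)}"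
    and min: "\<And>h :: 'a \<Rightarrow> nat. inj_on h (set u) \<Longrightarrow>
      weak_descents (map g u) \<le> weak_descents (map h u)"
  shows "ell u = weak_descents (map g u) + 1"
  unfolding ell_def
proof (rule Least_equality)
  show "contains (up (card (set u)) (weak_descents (map g u) + 1)) u"
    unfolding contains_iff_relabelling using g subseq_up[of "map g u"] by auto
next
  fix k
  assume "contains (up (card (set u)) k) u"
  then obtain h where h: "inj_on h (set u)" "subseq (map h u) (up (card (set u)) k)"
    by (auto simp: contains_iff_relabelling)
  have "0 < card (set u)"
    using \<open>u \<noteq> []\<close> by (simp add: card_gt_0_iff)
  moreover have "0 < k"
    using h(2) \<open>u \<noteq> []\<close> by (cases k) (auto simp: up_def)
  ultimately show "weak_descents (map g u) + 1 \<le> k"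
    using weak_descents_mono[OF h(2)] weak_descents_up[of "card (set u)" k] min[OF h(1)] by linarith
qed

text \<open>The added indicator is the junction from the last letter back to the first, so this is
  the cost of each additional copy in a repetition.\<close>

definition cyclic_descents :: "'a::linorder list \<Rightarrow> nat" where
  "cyclic_descents s = weak_descents s + of_bool (hd s \<le> last s)"

text \<open>On a circle there are \<open>length s\<close> adjacent pairs, each descending in exactly
  one direction. A one-letter word would count its closing pair in both.\<close>

lemma cyclic_descents_rev:
  assumes "distinct s" "2 \<le> length s"
  shows "cyclic_descents s + cyclic_descents (rev s) = length s"
proof -
  obtain x ys where s: "s = x # ys" "ys \<noteq> []"
    using assms(2) by (cases s) (auto simp: Suc_le_eq)
  then have "hd s \<noteq> last s"
    using assms(1) by auto
  then have "of_bool (hd s \<le> last s) + of_bool (last s \<le> hd s) = (1::nat)"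
    by auto
  then show ?thesis
    using weak_descents_rev[OF assms(1)] s
    by (simp add: cyclic_descents_def hd_rev last_rev del: weak_descents.simps)
qed

text \<open>A closed walk cannot rise strictly at every step: either the closing pair descends, or
  the last letter lies below the first and a descent occurs in between.\<close>

lemma cyclic_descents_pos:
  assumes "2 \<le> length s"
  shows "0 < cyclic_descents s"
proof -
  obtain x ys where s: "s = x # ys" "ys \<noteq> []"
    using assms by (cases s) (auto simp: Suc_le_eq)
  then have "subseq [x, last ys] s"
    by (simp add: subseq_singleton_left)
  then have "weak_descents [x, last ys] \<le> weak_descents s"
    by (rule weak_descents_mono)
  then have "of_bool (last s \<le> hd s) \<le> weak_descents s"
    using s by simp
  then show ?thesis
    by (cases "hd s \<le> last s") (auto simp: cyclic_descents_def not_le order.strict_implies_order)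
qed

section \<open>Weak descents of relabelled alternating sequences\<close>

lemma alt_seq_Suc:
  "alt_seq c (Suc n) e =
    alt_seq c n e @ rep (e (Suc n)) (if odd (Suc n) then I_seq c else D_seq c)"
  by (simp add: alt_seq_def)

lemma
  assumes "0 < c" "0 < n" "\<And>i. 1 \<le> i \<Longrightarrow> i \<le> n \<Longrightarrow> 0 < e i"
  shows set_alt_seq: "set (alt_seq c n e) = {1..c}"
    and last_alt_seq: "last (alt_seq c n e) = (if odd n then c else 1)"
proof -
  have "set (alt_seq c n e) = {1..c} \<and> last (alt_seq c n e) = (if odd n then c else 1)"
    using assms(2,3)
  proof (induction n rule: nat_induct_non_zero)
    case 1
    then show ?case
      using assms(1) by (simp add: alt_seq_def set_rep last_rep I_seq_facts)
  next
    case (Suc n)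
    then show ?case
      using assms(1)
      by (simp add: alt_seq_Suc set_rep last_rep D_seq_rev last_rev I_seq_facts)
  qed
  then show "set (alt_seq c n e) = {1..c}"
    and "last (alt_seq c n e) = (if odd n then c else 1)"
    by auto
qed

text \<open>The two \<open>of_bool\<close> terms on the left are the cyclic descents that are missing, once per block.\<close>

lemma weak_descents_alt_seq:
  fixes g :: "nat \<Rightarrow> nat"
  assumes c: "0 < c" and "0 < n" "\<And>i. 1 \<le> i \<Longrightarrow> i \<le> n \<Longrightarrow> 0 < e i"
  shows "weak_descents (map g (alt_seq c n e)) + 1
      + (n - n div 2) * of_bool (g 1 \<le> g c) + (n div 2) * of_bool (g c \<le> g 1)
    = (\<Sum>i\<in>{1..n}. if odd i then e i else 0) * cyclic_descents (map g (I_seq c))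
      + (\<Sum>i\<in>{1..n}. if even i then e i else 0) * cyclic_descents (map g (D_seq c)) + n"
  using assms(2,3)
proof (induction n rule: nat_induct_non_zero)
  case 1
  then show ?case
    using c weak_descents_rep[of "map g (I_seq c)" "e 1"]
    by (simp add: alt_seq_def map_rep I_seq_facts cyclic_descents_def hd_map last_map)
next
  case (Suc n)
  let ?s = "if odd (Suc n) then I_seq c else D_seq c"
  have s: "?s \<noteq> []" "hd ?s = (if odd n then c else 1)" "last ?s = (if odd n then 1 else c)"
    using c by (auto simp: D_seq_rev hd_rev last_rev I_seq_facts)
  have e: "0 < e (Suc n)"
    using Suc.prems by simp
  have "set (alt_seq c n e) = {1..c}"
    using set_alt_seq[of c n e] Suc c by simp
  then have ne: "alt_seq c n e \<noteq> []"
    using c by auto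
  have la: "last (alt_seq c n e) = (if odd n then c else 1)"
    using last_alt_seq[of c n e] Suc c by simp
  \<comment> \<open>Neighbouring blocks meet in the same letter, so every junction is a weak descent
    whatever \<open>g\<close> is. This produces the summand \<open>n\<close>.\<close>
  have "weak_descents (map g (alt_seq c (Suc n) e)) =
      weak_descents (map g (alt_seq c n e)) + 1 + weak_descents (rep (e (Suc n)) (map g ?s))"
    unfolding alt_seq_Suc map_append map_rep
    using ne s e la by (subst weak_descents_append) (auto simp: hd_rep hd_map last_map)
  moreover have "weak_descents (rep (e (Suc n)) (map g ?s)) +
      of_bool (g (if odd n then c else 1) \<le> g (if odd n then 1 else c)) =
      e (Suc n) * cyclic_descents (map g ?s)"
    using weak_descents_rep[of "map g ?s" "e (Suc n)"] s e
    by (simp add: cyclic_descents_def hd_map last_map)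
  \<comment> \<open>With the two indicators treated as unknown numbers, only arithmetic by the
    parity of \<open>n\<close> remains.\<close>
  moreover obtain x y :: nat where "of_bool (g 1 \<le> g c) = x" "of_bool (g c \<le> g 1) = y"
    by simp
  ultimately show ?case
    using Suc by (cases "odd n") (simp_all add: distrib_left distrib_right Suc_diff_le)
qed

text \<open>One unit of each weight gives \<open>A + B = min A B + max A B\<close>; each of the
  other \<open>p + q - 2\<close> units costs at least \<open>min A B\<close>.\<close>

lemma max_min_weighted_le:
  fixes p q A B :: nat
  assumes "0 < p" "0 < q"
  shows "(p + q - 1) * min A B + max A B \<le> A * p + B * q"
proof -
  obtain p' q' where "p = Suc p'" "q = Suc q'"
    using assms gr0_conv_Suc by auto
  then show ?thesis
    by (cases "A \<le> B") (auto simp: algebra_simps)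
qed

text \<open>A sum over \<open>{1..n}\<close> suits the induction that appends one block at a
  time.\<close>

lemma sum_odd_indices:
  fixes e :: "nat \<Rightarrow> nat"
  shows "(\<Sum>i\<in>{i. i \<ge> 1 \<and> 2 * i - 1 \<le> n}. e (2 * i - 1)) =
    (\<Sum>i\<in>{1..n}. if odd i then e i else 0)"
proof -
  have "(\<Sum>i\<in>{i. i \<ge> 1 \<and> 2 * i - 1 \<le> n}. e (2 * i - 1)) = (\<Sum>i\<in>{i\<in>{1..n}. odd i}. e i)"
    by (rule sum.reindex_bij_witness[of _ "\<lambda>i. Suc i div 2" "\<lambda>i. 2 * i - 1"])
       (auto elim!: oddE)
  then show ?thesis
    using sum.inter_filter[of "{1..n}" e odd] by simp
qed

lemma sum_even_indices:
  fixes e :: "nat \<Rightarrow> nat"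
  shows "(\<Sum>i\<in>{i. i \<ge> 1 \<and> 2 * i \<le> n}. e (2 * i)) =
    (\<Sum>i\<in>{1..n}. if even i then e i else 0)"
proof -
  have "(\<Sum>i\<in>{i. i \<ge> 1 \<and> 2 * i \<le> n}. e (2 * i)) = (\<Sum>i\<in>{i\<in>{1..n}. even i}. e i)"
    by (rule sum.reindex_bij_witness[of _ "\<lambda>i. i div 2" "\<lambda>i. 2 * i"]) auto
  then show ?thesis
    using sum.inter_filter[of "{1..n}" e even] by simp
qed

text \<open>The relabelling with \<open>q = 1\<close> keeps 1 and reverses \<open>2, \<dots>, c\<close>; the one with \<open>p = 1\<close> is the identity.\<close>

lemma optimal_relabelling:
  fixes c :: nat
  assumes "2 \<le> c"
  obtains g :: "nat \<Rightarrow> nat" where "inj_on g {1..c}" "g ` {1..c} \<subseteq> {1..c}" "g 1 < g c"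
    "cyclic_descents (map g (if b then I_seq c else D_seq c)) = 1"
proof (cases b)
  case True
  with assms show ?thesis
    by (intro that[of "\<lambda>i. i"]) (auto simp: cyclic_descents_def I_seq_facts)
next
  case False
  define g where "g = (\<lambda>i::nat. if i = 1 then 1 else c + 2 - i)"
  \<comment> \<open>The only cyclic descent is then the drop from \<open>c\<close> to 1, since the
    closing pair rises from 1 to 2.\<close>
  have "map g (D_seq c) = [2..<Suc c] @ [1]"
  proof -
    have "map g (rev [2..<Suc c]) = [2..<Suc c]"
      by (rule nth_equalityI) (auto simp: g_def rev_nth simp del: upt_Suc)
    moreover have "D_seq c = rev [2..<Suc c] @ [1]"
      using assms by (simp add: D_seq_def upt_conv_Cons numeral_2_eq_2 del: upt_Suc)
    ultimately show ?thesis
      by (simp add: g_def)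
  qed
  moreover have "weak_descents ([2..<Suc c] @ [1]) = 1"
    using assms
    by (subst weak_descents_append) (auto simp: weak_descents_strict_sorted simp del: upt_Suc)
  moreover have "hd ([2..<Suc c] @ [1]) = 2"
    using assms by (simp add: upt_conv_Cons del: upt_Suc)
  ultimately have "cyclic_descents (map g (D_seq c)) = 1"
    by (simp add: cyclic_descents_def del: upt_Suc)
  with assms False show ?thesis
    by (intro that[of g]) (auto simp: g_def inj_on_def split: if_splits)
qed

theorem theorem3p4:
  fixes c n :: nat and e :: "nat \<Rightarrow> nat" and u :: "nat list" and A B M m :: nat
  assumes "c \<ge> 2"
    and "n > 0"
    and "\<And>i. 1 \<le> i \<Longrightarrow> i \<le> n \<Longrightarrow> e i > 0"
    and "u = alt_seq c n e"
    and "A = (\<Sum>i\<in>{i. i \<ge> 1 \<and> 2 * i - 1 \<le> n}. e (2 * i - 1))"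
    and "B = (\<Sum>i\<in>{i. i \<ge> 1 \<and> 2 * i \<le> n}. e (2 * i))"
    and "M = max A B"
    and "m = min A B"
  shows "ell u = (c - 1) * m + M + n div 2"
proof -
  have set_u: "set u = {1..c}"
    unfolding assms(4) by (rule set_alt_seq) (use assms(1-3) in auto)
  let ?p = "\<lambda>g::nat \<Rightarrow> nat. cyclic_descents (map g (I_seq c))"
  let ?q = "\<lambda>g::nat \<Rightarrow> nat. cyclic_descents (map g (D_seq c))"
  have pq: "?p g + ?q g = c" "0 < ?p g" "0 < ?q g" if "inj_on g {1..c}" for g
    using that assms(1) cyclic_descents_rev[of "map g (I_seq c)"]
      cyclic_descents_pos[of "map g (I_seq c)"] cyclic_descents_pos[of "map g (D_seq c)"]
    by (simp_all add: D_seq_rev I_seq_facts distinct_map rev_map)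
  have count: "weak_descents (map g u) + 1
      + (n - n div 2) * of_bool (g 1 \<le> g c) + (n div 2) * of_bool (g c \<le> g 1)
    = A * ?p g + B * ?q g + n" for g :: "nat \<Rightarrow> nat"
    unfolding assms(4-6) sum_odd_indices sum_even_indices
    by (rule weak_descents_alt_seq) (use assms(1-3) in auto)
  have lower: "(c - 1) * m + M + n div 2 \<le> weak_descents (map g u) + 1"
    if g: "inj_on g {1..c}" for g :: "nat \<Rightarrow> nat"
  proof -
    have "g 1 \<noteq> g c"
      using inj_onD[OF g, of 1 c] assms(1) by auto
    \<comment> \<open>For \<open>g 1 < g c\<close> the remaining term is exactly
      \<open>n div 2\<close>; otherwise it is \<open>n - n div 2\<close>, which is no
      smaller.\<close>
    then have "A * ?p g + B * ?q g + n div 2 \<le> weak_descents (map g u) + 1"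
      using count[of g] by (cases "g 1 < g c") auto
    moreover have "(c - 1) * m + M \<le> A * ?p g + B * ?q g"
      using max_min_weighted_le[of "?p g" "?q g" A B] pq[OF g] assms(7,8) by simp
    ultimately show ?thesis by linarith
  qed
  \<comment> \<open>The block type with the larger exponent total gets cyclic count 1, and
    \<open>g 1 < g c\<close> selects the cheaper term \<open>n div 2\<close>.\<close>
  obtain g :: "nat \<Rightarrow> nat" where g: "inj_on g {1..c}" "g ` {1..c} \<subseteq> {1..c}" "g 1 < g c"
    and opt: "cyclic_descents (map g (if B \<le> A then I_seq c else D_seq c)) = 1"
    using optimal_relabelling[OF assms(1), where b = "B \<le> A"] by blast
  have "A * ?p g + B * ?q g = (c - 1) * m + M"
  proof (cases "B \<le> A")
    case True
    then have "?p g = 1" "?q g = c - 1"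
      using opt pq(1)[OF g(1)] by auto
    then show ?thesis
      using True assms(7,8) by (simp add: mult.commute)
  next
    case False
    then have "?q g = 1" "?p g = c - 1"
      using opt pq(1)[OF g(1)] by auto
    then show ?thesis
      using False assms(7,8) by (simp add: mult.commute)
  qed
  then have value_g: "weak_descents (map g u) + 1 = (c - 1) * m + M + n div 2"
    using count[of g] g(3) by auto
  have "ell u = weak_descents (map g u) + 1"
  proof (rule ell_eqI)
    show "u \<noteq> []"
      using set_u assms(1) by auto
    show "weak_descents (map g u) \<le> weak_descents (map h u)"
      if "inj_on h (set u)" for h :: "nat \<Rightarrow> nat"
      using lower[of h] that set_u value_g by simp
  qed (use g set_u in auto)
  with value_g show ?thesis by simp
qed

end
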